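(* Let $\alpha\in(0,1)$ and let $r,d\ge1$ be integers. Depending on the relations between $r$ and $d$, the sequence $(p_n^{r,d})_{n\ge0}$ is 1. increasing (for any $0<\alpha<1$) if $1\le r\le d-1$; 2. if $d\le r\le 2d-2$: (a) increasing (for all $n$) when $0<\alpha<\frac{d}{r+1}$, (b) increasing for large $n$ when $\frac{d}{r+1}\le\alpha<\frac{2d-1}{2r}$, (c) decreasing for large $n$ when $\frac{2d-1}{2r}\le\alpha<1$; 3. if $r=2d-1$: (a) increasing when $0<\alpha<\frac12$, (b) identically equal to $\frac12$ when $\alpha=\frac12$, (c) decreasing when $\frac12<\alpha<1$; 4. if $r\ge 2d$: (a) increasing for large $n$ when $0<\alpha\le\frac{2d-1}{2r}$, (b) decreasing for large $n$ when $\frac{2d-1}{2r}<\alpha\le\frac{d}{r+1}$, (c) decreasing (for all $n$) when $\frac{d}{r+1}<\alpha<1$.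
   Context: Let $\{X_i,X_i'\}_{i\ge1}$ be independent identically distributed random variables with $\mathbb{P}\{X_i=1\}=\alpha$ and $\mathbb{P}\{X_i=0\}=1-\alpha$. Put $S_k=X_1+\dots+X_k$ and $S_n'=X_1'+\dots+X_n'$ (with $S_0=S_0'=0$), so that $S_k$ and $S_n'$ are independent binomial random variables. For integers $r,d\ge1$ and $n\ge0$ define $p_n^{r,d}:=\mathbb{P}\{S_{n+r}\ge S_n'+d\}$ (this depends on $\alpha$). "Increasing/decreasing" stand for strictly increasing/strictly decreasing. "Increasing (decreasing) for large $n$" means that there is $n_0$, which may depend on $\alpha,r,d$, such that the sequence restricted to indices $n\ge n_0$ is increasing (decreasing).
   Formalization: In case 1 strict increase on all n fails if r≤d-2 (p_n=0 for n≤d-1-r, e.g. p_0=p_1=0 for r=1, d=3); what is proved is nondecreasing for all n≥0 and strictly increasing for n≥d-1-r, which is the original claim when r=d-1. *)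

theory Defs
  imports "HOL-Probability.Probability"
begin

definition partial_sum :: "(nat \<Rightarrow> 'a \<Rightarrow> real) \<Rightarrow> nat \<Rightarrow> 'a \<Rightarrow> real" where
  "partial_sum X k \<omega> = (\<Sum>i = 1..k. X i \<omega>)"

text \<open>
  The sum \<open>partial_sum X (n + r)\<close> is almost surely at most \<open>n + r\<close> for the variables below, so
  \<open>exceed_prob M X X' r d n\<close> vanishes as long as \<open>n + r < d\<close>. For \<open>r + 2 \<le> d\<close> the sequence
  therefore starts with at least two zeros and is strictly increasing only from index
  \<open>d - 1 - r\<close> on.
\<close>

definition exceed_prob ::
  "'a measure \<Rightarrow> (nat \<Rightarrow> 'a \<Rightarrow> real) \<Rightarrow> (nat \<Rightarrow> 'a \<Rightarrow> real) \<Rightarrow> nat \<Rightarrow> nat \<Rightarrow> nat \<Rightarrow> real" where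
  "exceed_prob M X X' r d n =
     measure M {\<omega> \<in> space M. partial_sum X (n + r) \<omega> \<ge> partial_sum X' n \<omega> + real d}"

text \<open>
  All the variables \<open>X i\<close>, \<open>X' i\<close> with \<open>i \<ge> 1\<close> are jointly independent: the two sequences are
  combined into one family indexed by the disjoint sum \<open>{1..} <+> {1..}\<close>. The two point
  probabilities add up to 1, so each variable lies in \<open>{0, 1}\<close> almost surely and
  all of them have the same distribution. The values \<open>X 0\<close> and \<open>X' 0\<close> play no role.
\<close>

definition iid_bernoulli_pair ::
  "'a measure \<Rightarrow> real \<Rightarrow> (nat \<Rightarrow> 'a \<Rightarrow> real) \<Rightarrow> (nat \<Rightarrow> 'a \<Rightarrow> real) \<Rightarrow> bool" where
  "iid_bernoulli_pair M \<alpha> X X' \<longleftrightarrow>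
     prob_space.indep_vars M (\<lambda>_. borel) (case_sum X X') ({1..} <+> {1..}) \<and>
     (\<forall>i\<ge>1. measure M {\<omega> \<in> space M. X i \<omega> = 1} = \<alpha> \<and>
            measure M {\<omega> \<in> space M. X i \<omega> = 0} = 1 - \<alpha> \<and>
            measure M {\<omega> \<in> space M. X' i \<omega> = 1} = \<alpha> \<and>
            measure M {\<omega> \<in> space M. X' i \<omega> = 0} = 1 - \<alpha>)"

definition increasing_seq :: "(nat \<Rightarrow> real) \<Rightarrow> bool" where
  "increasing_seq p \<longleftrightarrow> strict_mono p"

definition decreasing_seq :: "(nat \<Rightarrow> real) \<Rightarrow> bool" where
  "decreasing_seq p \<longleftrightarrow> monotone (<) (>) p"

definition increasing_for_large :: "(nat \<Rightarrow> real) \<Rightarrow> bool" where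
  "increasing_for_large p \<longleftrightarrow> (\<exists>n0. strict_mono_on {n0..} p)"

definition decreasing_for_large :: "(nat \<Rightarrow> real) \<Rightarrow> bool" where
  "decreasing_for_large p \<longleftrightarrow> (\<exists>n0. monotone_on {n0..} (<) (>) p)"

end

(*
  Increasing n by 1 adds a symmetric lazy step to the difference S_{n+r} - S'_n =: D_n, so
  p_{n+1} - p_n = s (P(D_n = d-1) - P(D_n = d)) with s = alpha (1 - alpha). Writing
  D_n = S_r + W_n with W_n a symmetric lazy walk and v_n(k) = P(W_n = k) - P(W_n = k+1), the sign of
  the increment is that of the sum of b(i) v_n(d-1-i), where b is the binomial distribution of S_r.

  For the statements about all n, v_n is odd about -1/2 and positive on 0..n, so the indices
  d-1-m and d+m can be paired, and log-concavity of b reduces the comparison of b(d-1-m) with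
  b(d+m) to m = 0, which is the threshold d/(r+1).

  For large n, v_n(k) is a Fourier integral of (1 - 2s + 2s cos t)^n sin((k+1/2)t) sin(t/2) over
  [0, pi]. The sign is decided by the sum of b(i) sin((d-1/2-i)t) near t = 0. Its first derivative
  there is d - 1/2 - r alpha. If this vanishes, the third derivative is the third central moment
  of S_r, which has the sign of 1 - 2 alpha.
*)

theory Submission
  imports Defs
begin

subsection \<open>Binomial averages\<close>

text \<open>The expectation of \<open>f\<close> at a binomial variable with parameters
  \<open>r\<close> and \<open>a\<close>. It is a polynomial in \<open>a\<close>, so the moment
  formulas hold for every real \<open>a\<close>.\<close>

definition binomial_mean :: "nat \<Rightarrow> real \<Rightarrow> (nat \<Rightarrow> real) \<Rightarrow> real" where
  "binomial_mean r a f = (\<Sum>i\<le>r. Bernstein r i a * f i)"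

lemma Bernstein_0_Suc: "Bernstein (Suc r) 0 a = (1 - a) * Bernstein r 0 a"
  by (simp add: Bernstein_def)

lemma Bernstein_Suc_Suc:
  "Bernstein (Suc r) (Suc i) a = a * Bernstein r i a + (1 - a) * Bernstein r (Suc i) a"
proof (cases "i < r")
  case True
  then have pw: "(1 - a) ^ (r - i) = (1 - a) * (1 - a) ^ (r - Suc i)"
    by (metis Suc_diff_Suc power_Suc)
  show ?thesis
    unfolding Bernstein_def diff_Suc_Suc pw binomial_Suc_Suc of_nat_add power_Suc
    by (simp add: algebra_simps)
qed (simp add: Bernstein_def binomial_eq_0)

text \<open>The ratio of neighbouring weights with denominators cleared, so that it also covers
  \<open>i = r\<close>, where both sides vanish.\<close>

lemma Bernstein_Suc_ratio:
  assumes "i \<le> r"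
  shows "Bernstein r (Suc i) a * (real (Suc i) * (1 - a)) = Bernstein r i a * ((real r - real i) * a)"
proof (cases "i = r")
  case False
  with assms have "i < r" by simp
  then have pw: "(1 - a) ^ (r - i) = (1 - a) * (1 - a) ^ (r - Suc i)"
    by (metis Suc_diff_Suc power_Suc)
  have "real (Suc i * (r choose Suc i)) = real ((r - i) * (r choose i))"
    by (simp only: binomial_absorption binomial_absorb_comp)
  then have "real (r choose Suc i) * real (Suc i) = real (r choose i) * (real r - real i)"
    using assms by (simp add: of_nat_diff algebra_simps)
  then show ?thesis by (simp add: Bernstein_def pw)
qed (simp add: Bernstein_def binomial_eq_0)

lemma Bernstein_eq_0: "r < i \<Longrightarrow> Bernstein r i a = 0"
  by (simp add: Bernstein_def binomial_eq_0)

lemma binomial_mean_0 [simp]: "binomial_mean 0 a f = f 0"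
  by (simp add: binomial_mean_def Bernstein_def)

text \<open>Conditioning on one of the \<open>r + 1\<close> trials.\<close>

lemma binomial_mean_Suc:
  "binomial_mean (Suc r) a f = a * binomial_mean r a (\<lambda>i. f (Suc i)) + (1 - a) * binomial_mean r a f"
proof -
  have "(\<Sum>i\<le>r. Bernstein r i a * f i) = (\<Sum>i\<le>Suc r. Bernstein r i a * f i)"
    by (simp add: Bernstein_eq_0)
  also have "\<dots> = Bernstein r 0 a * f 0 + (\<Sum>i\<le>r. Bernstein r (Suc i) a * f (Suc i))"
    by (rule sum.atMost_Suc_shift)
  finally show ?thesis
    unfolding binomial_mean_def sum.atMost_Suc_shift[of _ r]
    by (simp add: Bernstein_0_Suc Bernstein_Suc_Suc sum.distrib sum_subtractf sum_distrib_left algebra_simps)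
qed

lemma binomial_mean_const [simp]: "binomial_mean r a (\<lambda>_. c) = c"
  by (simp add: binomial_mean_def flip: sum_distrib_right)

lemma binomial_mean_cmult: "binomial_mean r a (\<lambda>i. c * f i) = c * binomial_mean r a f"
  by (simp add: binomial_mean_def sum_distrib_left mult.left_commute)

lemma binomial_mean_add:
  "binomial_mean r a (\<lambda>i. f i + g i) = binomial_mean r a f + binomial_mean r a g"
  by (simp add: binomial_mean_def sum.distrib distrib_left)

lemma binomial_mean_central:
  "binomial_mean r a (\<lambda>i. real i - real r * a) = 0"
proof -
  have "binomial_mean r a (\<lambda>i. real i + (- real r * a)) = 0"
    unfolding binomial_mean_add by (simp add: binomial_mean_def mult.commute)
  then show ?thesis by simp
qed

text \<open>Third central moments of independent variables add up, and one trial contributes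
  \<open>a * (1 - a) * (1 - 2 * a)\<close>.\<close>

lemma binomial_third_central_moment:
  "binomial_mean r a (\<lambda>i. (real i - real r * a) ^ 3) = real r * a * (1 - a) * (1 - 2 * a)"
proof (induction r)
  case (Suc r)
  define y where "y i = real i - real r * a" for i
  have "binomial_mean (Suc r) a (\<lambda>i. (real i - real (Suc r) * a) ^ 3)
      = binomial_mean r a (\<lambda>i. a * (y i + (1 - a)) ^ 3 + (1 - a) * (y i - a) ^ 3)"
    unfolding binomial_mean_Suc binomial_mean_add binomial_mean_cmult
    by (simp add: y_def algebra_simps)
  \<comment> \<open>The new trial has centred values \<open>1 - a\<close> and \<open>- a\<close>
    with mean 0, so the square of \<open>y i\<close> drops out; the linear term averages to
    0.\<close>
  also have "(\<lambda>i. a * (y i + (1 - a)) ^ 3 + (1 - a) * (y i - a) ^ 3)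
      = (\<lambda>i. y i ^ 3 + ((3 * a * (1 - a)) * y i + a * (1 - a) * (1 - 2 * a)))"
    by (rule ext) algebra
  also have "binomial_mean r a \<dots> = real (Suc r) * a * (1 - a) * (1 - 2 * a)"
    unfolding binomial_mean_add binomial_mean_cmult
    using Suc binomial_mean_central[of r a] by (simp add: y_def algebra_simps)
  finally show ?case .
qed simp

section \<open>Reflection of binomial weights about \<open>d - 1/2\<close>\<close>

text \<open>
  Let \<open>q m\<close> be the ratio of the weights at \<open>d + m\<close> and \<open>d - 1 - m\<close>, and \<open>c = r - d + 1\<close>, so that
  \<open>q 0 = c a / (d (1-a))\<close>. The next lemma gives \<open>q (m+1) / q m\<close>, which is at most \<open>(q 0)\<^sup>2\<close> if
  \<open>c \<le> d\<close> and at least \<open>(q 0)\<^sup>2\<close> if \<open>d \<le> c\<close>.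
\<close>

lemma Bernstein_reflect_step:
  assumes "Suc m < d" "d + m < r"
  shows "Bernstein r (d + Suc m) a * Bernstein r (d - 1 - m) a * ((real d ^ 2 - real (Suc m) ^ 2) * (1 - a) ^ 2)
       = Bernstein r (d + m) a * Bernstein r (d - 1 - Suc m) a * (((real r - real d + 1) ^ 2 - real (Suc m) ^ 2) * a ^ 2)"
proof -
  have 1: "Bernstein r (d + Suc m) a * ((real d + real m + 1) * (1 - a))
      = Bernstein r (d + m) a * ((real r - real d - real m) * a)"
    using Bernstein_Suc_ratio[of "d + m" r a] assms by (simp add: algebra_simps)
  have 2: "Bernstein r (d - 1 - m) a * ((real d - 1 - real m) * (1 - a))
      = Bernstein r (d - 1 - Suc m) a * ((real r - real d + real m + 2) * a)"
  proof -
    have "d - 1 - m = Suc (d - 1 - Suc m)" using assms by simp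
    moreover have "real (d - 1 - Suc m) = real d - real m - 2" using assms by (simp add: of_nat_diff)
    ultimately show ?thesis
      using Bernstein_Suc_ratio[of "d - 1 - Suc m" r a] assms by (simp add: algebra_simps)
  qed
  have "(Bernstein r (d + Suc m) a * ((real d + real m + 1) * (1 - a))) *
        (Bernstein r (d - 1 - m) a * ((real d - 1 - real m) * (1 - a)))
      = (Bernstein r (d + m) a * ((real r - real d - real m) * a)) *
        (Bernstein r (d - 1 - Suc m) a * ((real r - real d + real m + 2) * a))"
    unfolding 1 2 ..
  then show ?thesis
    by (simp add: algebra_simps power2_eq_square)
qed

text \<open>The source of the threshold: for \<open>0 < a < 1\<close> the weight at \<open>d\<close>
  is at most the one at \<open>d - 1\<close> exactly when
  \<open>a * (r + 1) \<le> d\<close>.\<close>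

lemma Bernstein_reflect_base:
  assumes "1 \<le> d" "d \<le> Suc r"
  shows "Bernstein r d a * (real d * (1 - a)) = Bernstein r (d - 1) a * ((real r - real d + 1) * a)"
  using Bernstein_Suc_ratio[of "d - 1" r a] assms by (simp add: of_nat_diff algebra_simps)

text \<open>In the notation above, \<open>ad\<close> says \<open>q 0 \<le> 1\<close> and the bound
  on \<open>r\<close> says \<open>c \<le> d\<close>, so each step multiplies \<open>q\<close> by at
  most \<open>q 0 ^ 2 \<le> 1\<close>. Beyond \<open>r\<close> the weight at \<open>d + m\<close> is
  0.\<close>

lemma Bernstein_reflect_le:
  assumes a: "0 < a" "a < 1" and r: "r \<le> 2 * d - 1" and ad: "a * (real r + 1) \<le> real d"
  shows "m < d \<Longrightarrow> Bernstein r (d + m) a \<le> Bernstein r (d - 1 - m) a"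
proof (induction m)
  case 0
  show ?case
  proof (cases "d \<le> r")
    case True
    have p: "0 \<le> Bernstein r (d - 1) a" using a by (intro Bernstein_nonneg) auto
    have "(real r - real d + 1) * a \<le> real d * (1 - a)" using ad by (simp add: algebra_simps)
    from mult_left_mono[OF this p]
    have "Bernstein r d a * (real d * (1 - a)) \<le> Bernstein r (d - 1) a * (real d * (1 - a))"
      using True 0 by (subst Bernstein_reflect_base) auto
    then show ?thesis using 0 a by simp
  qed (use a in \<open>simp add: Bernstein_eq_0 Bernstein_nonneg\<close>)
next
  case (Suc m)
  show ?case
  proof (cases "d + m < r")
    case False
    then show ?thesis using a by (simp add: Bernstein_eq_0 Bernstein_nonneg)
  next
    case True
    let ?c = "real r - real d + 1" and ?x = "real (Suc m)"
    have xd: "?x < real d" and xc: "?x < ?c" using Suc.prems True by auto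
    have cd: "?c \<le> real d" using r Suc.prems by linarith
    have x2: "?x ^ 2 < real d ^ 2" "?x ^ 2 < ?c ^ 2" "?c ^ 2 \<le> real d ^ 2"
      using xd xc cd by (auto intro!: power_strict_mono power_mono)
    have "?c * a \<le> real d * (1 - a)" using ad by (simp add: algebra_simps)
    then have "(?c * a) ^ 2 \<le> (real d * (1 - a)) ^ 2"
      using xc a by (intro power_mono) auto
    then have sq: "?c ^ 2 * a ^ 2 \<le> real d ^ 2 * (1 - a) ^ 2" by (simp add: power_mult_distrib)
    \<comment> \<open>This is \<open>(c^2 - x^2) / (d^2 - x^2) \<le> c^2 / d^2\<close> for
      \<open>c \<le> d\<close>, cleared of denominators; the factor \<open>d^2\<close> is cancelled
      in \<open>key\<close>.\<close>
    have "real d ^ 2 * ((?c ^ 2 - ?x ^ 2) * a ^ 2) \<le> (real d ^ 2 - ?x ^ 2) * (?c ^ 2 * a ^ 2)"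
      using mult_right_mono[OF mult_left_mono[OF x2(3), of "?x ^ 2"], of "a ^ 2"]
      by (simp add: algebra_simps)
    also have "\<dots> \<le> (real d ^ 2 - ?x ^ 2) * (real d ^ 2 * (1 - a) ^ 2)"
      using sq x2(1) by (intro mult_left_mono) (simp_all only: diff_ge_0_iff_ge less_imp_le)
    finally have key: "(?c ^ 2 - ?x ^ 2) * a ^ 2 \<le> (real d ^ 2 - ?x ^ 2) * (1 - a) ^ 2"
      using xd by (simp add: mult.left_commute[of _ "real d ^ 2"])
    let ?K = "(real d ^ 2 - ?x ^ 2) * (1 - a) ^ 2"
    let ?B = "\<lambda>i. Bernstein r i a"
    have K: "0 < ?K" using x2 a by simp
    have IH: "?B (d + m) \<le> ?B (d - 1 - m)" using Suc by simp
    have pos: "0 < ?B (d + m)" "0 < ?B (d - 1 - m)" "0 \<le> ?B (d - 1 - Suc m)"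
      using True a by (auto intro!: Bernstein_pos Bernstein_nonneg)
    have "?B (d + Suc m) * (?B (d - 1 - m) * ?K)
        = ?B (d + m) * ?B (d - 1 - Suc m) * ((?c ^ 2 - ?x ^ 2) * a ^ 2)"
      using Bernstein_reflect_step[of m d r a] Suc.prems True by (simp add: mult.assoc)
    also have "\<dots> \<le> ?B (d - 1 - m) * ?B (d - 1 - Suc m) * ?K"
      by (rule mult_mono[OF mult_right_mono[OF IH pos(3)] key])
         (use pos x2(2) in \<open>simp_all del: of_nat_Suc\<close>)
    finally have "?B (d + Suc m) * (?B (d - 1 - m) * ?K) \<le> ?B (d - 1 - Suc m) * (?B (d - 1 - m) * ?K)"
      by (simp add: ac_simps)
    from mult_right_le_imp_le[OF this mult_pos_pos[OF pos(2) K]] show ?thesis .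
  qed
qed

text \<open>The same induction with the inequalities reversed. Here \<open>2 * d - 1 \<le> r\<close>
  keeps \<open>d + m\<close> at most \<open>r\<close>, so no vanishing weights intervene.\<close>

lemma Bernstein_reflect_ge:
  assumes a: "0 < a" "a < 1" and r: "2 * d - 1 \<le> r" and ad: "real d \<le> a * (real r + 1)"
  shows "m < d \<Longrightarrow> Bernstein r (d - 1 - m) a \<le> Bernstein r (d + m) a"
proof (induction m)
  case 0
  have p: "0 \<le> Bernstein r (d - 1) a" using a by (intro Bernstein_nonneg) auto
  have "real d * (1 - a) \<le> (real r - real d + 1) * a" using ad by (simp add: algebra_simps)
  from mult_left_mono[OF this p]
  have "Bernstein r (d - 1) a * (real d * (1 - a)) \<le> Bernstein r d a * (real d * (1 - a))"
    using r 0 by (subst Bernstein_reflect_base) auto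
  then show ?case using 0 a by simp
next
  case (Suc m)
  have dm: "d + m < r" using Suc.prems r by linarith
  let ?c = "real r - real d + 1" and ?x = "real (Suc m)"
  have xd: "?x < real d" using Suc.prems by simp
  have cd: "real d \<le> ?c" using r Suc.prems by linarith
  have x2: "?x ^ 2 < real d ^ 2" "real d ^ 2 \<le> ?c ^ 2"
    using xd cd by (auto intro!: power_strict_mono power_mono)
  have "real d * (1 - a) \<le> ?c * a" using ad by (simp add: algebra_simps)
  then have "(real d * (1 - a)) ^ 2 \<le> (?c * a) ^ 2"
    using a by (intro power_mono) auto
  then have sq: "real d ^ 2 * (1 - a) ^ 2 \<le> ?c ^ 2 * a ^ 2" by (simp add: power_mult_distrib)
  have "(real d ^ 2 - ?x ^ 2) * (real d ^ 2 * (1 - a) ^ 2) \<le> (real d ^ 2 - ?x ^ 2) * (?c ^ 2 * a ^ 2)"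
    using sq x2(1) by (intro mult_left_mono) (simp_all only: diff_ge_0_iff_ge less_imp_le)
  also have "\<dots> \<le> real d ^ 2 * ((?c ^ 2 - ?x ^ 2) * a ^ 2)"
    using mult_right_mono[OF mult_left_mono[OF x2(2), of "?x ^ 2"], of "a ^ 2"]
    by (simp add: algebra_simps)
  finally have key: "(real d ^ 2 - ?x ^ 2) * (1 - a) ^ 2 \<le> (?c ^ 2 - ?x ^ 2) * a ^ 2"
    using xd by (simp add: mult.left_commute[of _ "real d ^ 2"])
  let ?K = "(real d ^ 2 - ?x ^ 2) * (1 - a) ^ 2"
  let ?B = "\<lambda>i. Bernstein r i a"
  have K: "0 < ?K" using x2 a by simp
  have IH: "?B (d - 1 - m) \<le> ?B (d + m)" using Suc by simp
  have pos: "0 < ?B (d + m)" "0 < ?B (d - 1 - m)" "0 \<le> ?B (d - 1 - Suc m)"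
    using dm a by (auto intro!: Bernstein_pos Bernstein_nonneg)
  have "?B (d - 1 - Suc m) * (?B (d - 1 - m) * ?K)
      = ?B (d - 1 - m) * ?B (d - 1 - Suc m) * ?K" by (simp add: ac_simps)
  also have "\<dots> \<le> ?B (d + m) * ?B (d - 1 - Suc m) * ((?c ^ 2 - ?x ^ 2) * a ^ 2)"
    by (rule mult_mono[OF mult_right_mono[OF IH pos(3)] key])
       (use pos less_imp_le[OF K] in simp_all)
  also have "\<dots> = ?B (d + Suc m) * (?B (d - 1 - m) * ?K)"
    using Bernstein_reflect_step[of m d r a] Suc.prems dm by (simp add: mult.assoc)
  finally have "?B (d - 1 - Suc m) * (?B (d - 1 - m) * ?K) \<le> ?B (d + Suc m) * (?B (d - 1 - m) * ?K)" .
  from mult_right_le_imp_le[OF this mult_pos_pos[OF pos(2) K]] show ?case .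
qed

subsection \<open>The second difference of the tails\<close>

text \<open>For the walk from 0 moving by 1 or -1 with probability \<open>s\<close> each, this is
  the point probability at \<open>k\<close> minus the one at \<open>k + 1\<close>.\<close>

primrec lazy_diff :: "real \<Rightarrow> nat \<Rightarrow> int \<Rightarrow> real" where
  "lazy_diff s 0 k = (if k = 0 then 1 else if k = -1 then -1 else 0)"
| "lazy_diff s (Suc n) k =
     (1 - 2 * s) * lazy_diff s n k + s * (lazy_diff s n (k - 1) + lazy_diff s n (k + 1))"

lemma lazy_diff_reflect: "lazy_diff s n (- 1 - k) = - lazy_diff s n k"
proof (induction n arbitrary: k)
  case (Suc n)
  have "lazy_diff s n (- 1 - k - 1) = - lazy_diff s n (k + 1)"
       "lazy_diff s n (- 1 - k + 1) = - lazy_diff s n (k - 1)"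
    using Suc[of "k + 1"] Suc[of "k - 1"] by (simp_all add: algebra_simps)
  then show ?case using Suc[of k] by (simp add: algebra_simps)
qed auto

text \<open>For \<open>k > 0\<close> the recursion combines nonnegative values with nonnegative
  coefficients, and positivity spreads by one site per step.\<close>

lemma lazy_diff_nonneg_pos:
  fixes k :: int
  assumes "0 < s" "s \<le> 1 / 4" "0 \<le> k"
  shows "0 \<le> lazy_diff s n k \<and> (k \<le> int n \<longrightarrow> 0 < lazy_diff s n k)"
  using \<open>0 \<le> k\<close>
proof (induction n arbitrary: k)
  case (Suc n)
  show ?case
  proof (cases "k = 0")
    case True
    \<comment> \<open>By reflection the value at -1 is minus the value at 0;
      \<open>s \<le> 1 / 4\<close> keeps the resulting coefficient \<open>1 - 3 * s\<close>
      positive.\<close>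
    have "lazy_diff s (Suc n) k = (1 - 3 * s) * lazy_diff s n 0 + s * lazy_diff s n 1"
      using lazy_diff_reflect[of s n 0] True by (simp add: algebra_simps)
    moreover have "0 < (1 - 3 * s) * lazy_diff s n 0" "0 \<le> s * lazy_diff s n 1"
      using Suc.IH[of 0] Suc.IH[of 1] assms by auto
    ultimately show ?thesis by linarith
  next
    case False
    have n: "0 \<le> (1 - 2 * s) * lazy_diff s n k" "0 \<le> s * lazy_diff s n (k - 1)"
         "0 \<le> s * lazy_diff s n (k + 1)"
      using Suc.IH[of k] Suc.IH[of "k - 1"] Suc.IH[of "k + 1"] Suc.prems False assms by auto
    moreover have "k \<le> int (Suc n) \<Longrightarrow> 0 < s * lazy_diff s n (k - 1)"
      using Suc.IH[of "k - 1"] Suc.prems False assms by auto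
    ultimately show ?thesis by (auto simp: distrib_left)
  qed
qed auto

text \<open>The indices \<open>d - 1 - m\<close> and \<open>d + m\<close> give the arguments
  \<open>m\<close> and \<open>- 1 - m\<close>, hence opposite values. Indices from
  \<open>2 * d\<close> on have no partner; reflection makes their arguments nonnegative.\<close>

lemma binomial_mean_lazy_diff:
  "binomial_mean r a (\<lambda>i. lazy_diff s n (int d - 1 - int i)) =
     (\<Sum>m<d. (Bernstein r (d - 1 - m) a - Bernstein r (d + m) a) * lazy_diff s n (int m))
     - (\<Sum>i\<in>{2 * d..r}. Bernstein r i a * lazy_diff s n (int i - int d))"
proof -
  define F where "F i = Bernstein r i a * lazy_diff s n (int d - 1 - int i)" for i
  have "binomial_mean r a (\<lambda>i. lazy_diff s n (int d - 1 - int i)) = sum F {..r}"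
    by (simp add: binomial_mean_def F_def)
  \<comment> \<open>For \<open>r < 2 * d - 1\<close> this adds indices of weight 0, so that every
    \<open>m < d\<close> has a full pair.\<close>
  also have "\<dots> = sum F ({..<2 * d} \<union> {2 * d..r})"
    by (rule sum.mono_neutral_left) (auto simp: F_def Bernstein_eq_0)
  also have "\<dots> = sum F {..<2 * d} + sum F {2 * d..r}"
    by (rule sum.union_disjoint) auto
  also have "sum F {..<2 * d} = sum F {..<d} + sum F {d..<2 * d}"
    by (simp add: lessThan_atLeast0 sum.atLeastLessThan_concat)
  also have "sum F {..<d} = (\<Sum>m<d. F (d - 1 - m))"
    using sum.nat_diff_reindex[of F d] by simp
  also have "\<dots> = (\<Sum>m<d. Bernstein r (d - 1 - m) a * lazy_diff s n (int m))"
    by (intro sum.cong) (auto simp: F_def of_nat_diff)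
  also have "sum F {d..<2 * d} = (\<Sum>m<d. F (d + m))"
    using sum.shift_bounds_nat_ivl[of F 0 d d] by (simp add: mult_2 lessThan_atLeast0 add.commute)
  also have "\<dots> = (\<Sum>m<d. - (Bernstein r (d + m) a * lazy_diff s n (int m)))"
  proof (intro sum.cong refl)
    fix m
    have "int d - 1 - int (d + m) = - 1 - int m" by simp
    then show "F (d + m) = - (Bernstein r (d + m) a * lazy_diff s n (int m))"
      unfolding F_def by (metis lazy_diff_reflect mult_minus_right)
  qed
  also have "sum F {2 * d..r} = (\<Sum>i\<in>{2 * d..r}. - (Bernstein r i a * lazy_diff s n (int i - int d)))"
  proof (intro sum.cong refl)
    fix i
    have "int d - 1 - int i = - 1 - (int i - int d)" by simp
    then show "F i = - (Bernstein r i a * lazy_diff s n (int i - int d))"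
      unfolding F_def by (metis lazy_diff_reflect mult_minus_right)
  qed
  finally show ?thesis
    by (simp add: sum_negf sum_subtractf left_diff_distrib)
qed

text \<open>The bound on \<open>r\<close> leaves no unpaired index, and every pair is nonnegative.
  Strictness needs one positive pair at a site the walk can reach by time \<open>n\<close>.\<close>

lemma binomial_mean_lazy_diff_pos:
  assumes a: "0 < a" "a < 1" and d: "1 \<le> d" and s: "0 < s" "s \<le> 1 / 4"
    and r: "r \<le> 2 * d - 1" and ad: "a * (real r + 1) < real d"
  shows "0 \<le> binomial_mean r a (\<lambda>i. lazy_diff s n (int d - 1 - int i))"
    and "d - 1 \<le> n + r \<Longrightarrow> 0 < binomial_mean r a (\<lambda>i. lazy_diff s n (int d - 1 - int i))"
proof -
  let ?t = "\<lambda>m. (Bernstein r (d - 1 - m) a - Bernstein r (d + m) a) * lazy_diff s n (int m)"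
  have eq: "binomial_mean r a (\<lambda>i. lazy_diff s n (int d - 1 - int i)) = sum ?t {..<d}"
    using r d by (subst binomial_mean_lazy_diff) simp
  have nn: "0 \<le> ?t m" if "m < d" for m
    using Bernstein_reflect_le[OF a r less_imp_le[OF ad] that] lazy_diff_nonneg_pos[OF s, of "int m" n]
    by simp
  show "0 \<le> binomial_mean r a (\<lambda>i. lazy_diff s n (int d - 1 - int i))"
    unfolding eq using nn by (intro sum_nonneg) auto
  assume n: "d - 1 \<le> n + r"
  show "0 < binomial_mean r a (\<lambda>i. lazy_diff s n (int d - 1 - int i))"
  proof (cases "d \<le> Suc r")
    case True
    have p: "0 < Bernstein r (d - 1) a" using a True by (intro Bernstein_pos) auto
    have "(real r - real d + 1) * a < real d * (1 - a)" using ad by (simp add: algebra_simps)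
    from mult_strict_left_mono[OF this p]
    have "Bernstein r d a * (real d * (1 - a)) < Bernstein r (d - 1) a * (real d * (1 - a))"
      using True d by (subst Bernstein_reflect_base) auto
    then have "0 < ?t 0" using a d lazy_diff_nonneg_pos[OF s, of 0 n] by simp
    then show ?thesis
      unfolding eq using nn d by (intro sum_pos2[of _ 0]) auto
  next
    case False
    \<comment> \<open>The pair \<open>m = d - 1 - r\<close> contains \<open>r\<close>, the last
      index of positive weight, while its partner exceeds \<open>r\<close>. The condition
      \<open>d - 1 \<le> n + r\<close> is \<open>m \<le> n\<close>.\<close>
    then have "0 < Bernstein r (d - 1 - (d - 1 - r)) a" "Bernstein r (d + (d - 1 - r)) a = 0"
      using a by (auto intro!: Bernstein_pos Bernstein_eq_0)
    moreover have "0 < lazy_diff s n (int (d - 1 - r))"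
      using lazy_diff_nonneg_pos[OF s, of "int (d - 1 - r)" n] n by auto
    ultimately have "0 < ?t (d - 1 - r)" by simp
    then show ?thesis
      unfolding eq using nn d False by (intro sum_pos2[of _ "d - 1 - r"]) auto
  qed
qed

text \<open>Now the pairs are at most 0, strictly for \<open>m = 0\<close>, and the unpaired indices
  subtract a nonnegative amount.\<close>

lemma binomial_mean_lazy_diff_neg:
  assumes a: "0 < a" "a < 1" and d: "1 \<le> d" and s: "0 < s" "s \<le> 1 / 4"
    and r: "2 * d - 1 \<le> r" and ad: "real d < a * (real r + 1)"
  shows "binomial_mean r a (\<lambda>i. lazy_diff s n (int d - 1 - int i)) < 0"
proof -
  let ?t = "\<lambda>m. (Bernstein r (d + m) a - Bernstein r (d - 1 - m) a) * lazy_diff s n (int m)"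
  have nn: "0 \<le> ?t m" if "m < d" for m
    using Bernstein_reflect_ge[OF a r less_imp_le[OF ad] that] lazy_diff_nonneg_pos[OF s, of "int m" n]
    by simp
  have p: "0 < Bernstein r (d - 1) a" using a r d by (intro Bernstein_pos) auto
  have "real d * (1 - a) < (real r - real d + 1) * a" using ad by (simp add: algebra_simps)
  from mult_strict_left_mono[OF this p]
  have "Bernstein r (d - 1) a * (real d * (1 - a)) < Bernstein r d a * (real d * (1 - a))"
    using r d by (subst Bernstein_reflect_base) auto
  then have "0 < ?t 0" using a d lazy_diff_nonneg_pos[OF s, of 0 n] by simp
  then have "0 < sum ?t {..<d}"
    using nn d by (intro sum_pos2[of _ 0]) auto
  moreover have "0 \<le> (\<Sum>i\<in>{2 * d..r}. Bernstein r i a * lazy_diff s n (int i - int d))"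
    using a lazy_diff_nonneg_pos[OF s] by (intro sum_nonneg mult_nonneg_nonneg Bernstein_nonneg) auto
  moreover have "(\<Sum>m<d. (Bernstein r (d - 1 - m) a - Bernstein r (d + m) a) * lazy_diff s n (int m))
      = - sum ?t {..<d}"
    by (simp add: sum_negf[symmetric] left_diff_distrib)
  ultimately show ?thesis
    unfolding binomial_mean_lazy_diff by linarith
qed

subsection \<open>Large times\<close>

lemma integral_cos_int:
  fixes k :: int
  shows "((\<lambda>t. cos (of_int k * t)) has_integral (if k = 0 then pi else 0)) {0..pi}"
proof (cases "k = 0")
  case True
  then show ?thesis using has_integral_const_real[of "1::real" 0 pi] by simp
next
  case False
  have "((\<lambda>t. cos (of_int k * t)) has_integral
      (sin (of_int k * pi) / of_int k - sin (of_int k * 0) / of_int k)) {0..pi}"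
    using False
    by (intro fundamental_theorem_of_calculus)
       (auto intro!: derivative_eq_intros simp: has_real_derivative_iff_has_vector_derivative[symmetric])
  moreover have "sin (of_int k * pi) = 0" using sin_npi_int[of k] by (simp add: mult.commute)
  ultimately show ?thesis using False by simp
qed

text \<open>For \<open>n = 0\<close> this is the orthogonality of cosines. A step of the recursion
  multiplies the integrand by \<open>1 - 2 * s + 2 * s * cos t\<close>, since
  \<open>sin (x - t) + sin (x + t) = 2 * sin x * cos t\<close>.\<close>

lemma lazy_diff_has_integral:
  "((\<lambda>t. (1 - 2 * s + 2 * s * cos t) ^ n * (sin ((2 * of_int k + 1) / 2 * t) * sin (t / 2)))
     has_integral (pi / 2 * lazy_diff s n k)) {0..pi}"
proof (induction n arbitrary: k)
  case 0
  have *: "sin ((2 * of_int k + 1) / 2 * t) * sin (t / 2)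
      = (1 / 2) * (cos (of_int k * t) - cos (of_int (k + 1) * t))" for t :: real
  proof -
    have "of_int k * t = (2 * of_int k + 1) / 2 * t - t / 2"
         "of_int (k + 1) * t = (2 * of_int k + 1) / 2 * t + t / 2"
      by (simp_all add: algebra_simps add_divide_distrib)
    then show ?thesis by (simp only: cos_diff cos_add) simp
  qed
  have "((\<lambda>t. (1 / 2) * (cos (of_int k * t) - cos (of_int (k + 1) * t))) has_integral
      ((1 / 2) * ((if k = 0 then pi else 0) - (if k + 1 = 0 then pi else 0)))) {0..pi}"
    by (intro has_integral_mult_right has_integral_diff integral_cos_int)
  moreover have "(1 / 2) * ((if k = 0 then pi else 0) - (if k + 1 = 0 then pi else 0)) = pi / 2 * lazy_diff s 0 k"
    by (cases "k = 0"; cases "k = -1") simp_all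
  ultimately show ?case by (simp only: * power_0 mult_1_left)
next
  case (Suc n)
  define P where "P t = (1 - 2 * s + 2 * s * cos t) ^ n" for t :: real
  define S where "S k t = P t * (sin ((2 * of_int k + 1) / 2 * t) * sin (t / 2))"
    for k :: int and t :: real
  have *: "(1 - 2 * s + 2 * s * cos t) ^ Suc n * (sin ((2 * of_int k + 1) / 2 * t) * sin (t / 2))
      = (1 - 2 * s) * S k t + s * (S (k - 1) t + S (k + 1) t)" for t :: real
  proof -
    have "(2 * of_int (k - 1) + 1) / 2 * t = (2 * of_int k + 1) / 2 * t - t"
         "(2 * of_int (k + 1) + 1) / 2 * t = (2 * of_int k + 1) / 2 * t + t"
      by (simp_all add: field_simps)
    \<comment> \<open>\<open>A\<close>, \<open>B\<close> are sine and cosine of the angle at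
      \<open>k\<close>, and \<open>D\<close>, \<open>C\<close> those of \<open>t\<close>; the terms
      \<open>B * D\<close> cancel.\<close>
    moreover have "(1 - 2 * s + 2 * s * C) * p * (A * h)
        = (1 - 2 * s) * (p * (A * h)) + s * (p * ((A * C - B * D) * h) + p * ((A * C + B * D) * h))"
      for A B C D h p :: real
      by (simp add: algebra_simps)
    ultimately show ?thesis
      unfolding S_def power_Suc P_def[symmetric] by (simp only: sin_diff sin_add)
  qed
  have "((\<lambda>t. (1 - 2 * s) * S k t + s * (S (k - 1) t + S (k + 1) t)) has_integral
      ((1 - 2 * s) * (pi / 2 * lazy_diff s n k)
        + s * (pi / 2 * lazy_diff s n (k - 1) + pi / 2 * lazy_diff s n (k + 1)))) {0..pi}"
    using Suc[folded P_def, folded S_def] by (intro has_integral_add has_integral_mult_right)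
  moreover have "(1 - 2 * s) * (pi / 2 * lazy_diff s n k)
      + s * (pi / 2 * lazy_diff s n (k - 1) + pi / 2 * lazy_diff s n (k + 1)) = pi / 2 * lazy_diff s (Suc n) k"
    by (simp add: field_simps)
  ultimately show ?case by (simp only: *)
qed

text \<open>Laplace's principle: the peak of the kernel at \<open>0\<close> decides the sign.\<close>

lemma eventually_integral_power_pos:
  fixes \<phi> G :: "real \<Rightarrow> real"
  assumes cont: "continuous_on {0..b} \<phi>" "continuous_on {0..b} G"
    and anti: "\<And>x y. 0 \<le> x \<Longrightarrow> x < y \<Longrightarrow> y \<le> b \<Longrightarrow> \<phi> y < \<phi> x"
    and nonneg: "\<And>x. 0 \<le> x \<Longrightarrow> x \<le> b \<Longrightarrow> 0 \<le> \<phi> x"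
    and e0: "0 < e0" "e0 \<le> b" "\<And>x. 0 < x \<Longrightarrow> x < e0 \<Longrightarrow> 0 < G x"
  shows "\<forall>\<^sub>F n in sequentially. 0 < integral {0..b} (\<lambda>t. \<phi> t ^ n * G t)"
proof -
  \<comment> \<open>Halving makes \<open>G\<close> positive up to and including the endpoint
    \<open>e\<close>.\<close>
  define e where "e = e0 / 2"
  have e: "0 < e" "e \<le> b" "\<And>x. 0 < x \<Longrightarrow> x \<le> e \<Longrightarrow> 0 < G x"
    using e0 by (auto simp: e_def)
  \<comment> \<open>The peak is measured on \<open>{0..c}\<close> and the tail on
    \<open>{e..b}\<close>; as \<open>c < e\<close>, the gap \<open>\<phi> e < \<phi> c\<close> makes
    the peak win exponentially.\<close>
  define c where "c = e / 2"
  have c: "0 < c" "c < e" using e by (auto simp: c_def)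
  define I where "I = integral {0..c} G"
  define K where "K = integral {e..b} (\<lambda>t. \<bar>G t\<bar>)"
  have contn: "continuous_on {0..b} (\<lambda>t. \<phi> t ^ n * G t)" for n
    using cont by (intro continuous_intros)
  have int: "(\<lambda>t. \<phi> t ^ n * G t) integrable_on {x..y}" if "0 \<le> x" "y \<le> b" for n x y
    using that by (intro integrable_continuous_real continuous_on_subset[OF contn]) auto
  have intG: "G integrable_on {x..y}" "(\<lambda>t. \<bar>G t\<bar>) integrable_on {x..y}" if "0 \<le> x" "y \<le> b" for x y
    using that by (auto intro!: integrable_continuous_real continuous_intros continuous_on_subset[OF cont(2)])
  have I: "0 < I"
    using integral_less_real[of 0 c "\<lambda>_. 0" G] c e continuous_on_subset[OF cont(2), of "{0..c}"]
    by (auto simp: I_def)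
  \<comment> \<open>\<open>G\<close> is only known to be positive to the right of 0; continuity
    supplies the endpoint.\<close>
  have G0: "0 \<le> G x" if "0 \<le> x" "x \<le> e" for x
  proof (cases "x = 0")
    case True
    have "continuous_on {0..c} G" using cont(2) c e by (auto intro: continuous_on_subset)
    then have "(G \<longlongrightarrow> G 0) (at_right 0)"
      using c by (simp add: continuous_on_Icc_at_rightD)
    moreover have "\<forall>\<^sub>F x in at_right 0. 0 \<le> G x"
      using e by (auto simp: eventually_at_right[of 0 1] intro!: exI[of _ e] less_imp_le)
    ultimately show ?thesis
      using True tendsto_lowerbound by (metis trivial_limit_at_right_real)
  qed (use e that in \<open>auto intro: less_imp_le\<close>)
  have main: "\<phi> c ^ n * I - \<phi> e ^ n * K \<le> integral {0..b} (\<lambda>t. \<phi> t ^ n * G t)" for n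
  proof -
    let ?f = "\<lambda>t. \<phi> t ^ n * G t"
    have split: "integral {0..b} ?f = integral {0..c} ?f + integral {c..e} ?f + integral {e..b} ?f"
      using c e int[of 0 b n] int[of 0 e n]
      by (simp add: Henstock_Kurzweil_Integration.integral_combine)
    have 1: "\<phi> c ^ n * I \<le> integral {0..c} ?f"
    proof -
      have "\<phi> c ^ n * I = integral {0..c} (\<lambda>t. \<phi> c ^ n * G t)" by (simp add: I_def)
      also have "\<dots> \<le> integral {0..c} ?f"
      proof (rule integral_le)
        fix x assume x: "x \<in> {0..c}"
        have "\<phi> c \<le> \<phi> x" using anti[of x c] x c e by (cases "x = c") auto
        then show "\<phi> c ^ n * G x \<le> \<phi> x ^ n * G x"
          using x c e G0[of x] nonneg[of c] by (intro mult_right_mono power_mono) auto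
      qed (use c e int[of 0 c n] intG(1)[of 0 c] in \<open>auto intro: integrable_on_mult_right\<close>)
      finally show ?thesis .
    qed
    have 2: "0 \<le> integral {c..e} ?f"
      using c e G0 nonneg int[of c e n]
      by (intro integral_nonneg mult_nonneg_nonneg zero_le_power) auto
    have 3: "- (\<phi> e ^ n * K) \<le> integral {e..b} ?f"
    proof -
      have "- (\<phi> e ^ n * K) = integral {e..b} (\<lambda>t. - (\<phi> e ^ n * \<bar>G t\<bar>))" by (simp add: K_def)
      also have "\<dots> \<le> integral {e..b} ?f"
      proof (rule integral_le)
        fix x assume x: "x \<in> {e..b}"
        have "\<phi> x \<le> \<phi> e" using anti[of e x] x e by (cases "x = e") auto
        then have "\<phi> x ^ n * \<bar>G x\<bar> \<le> \<phi> e ^ n * \<bar>G x\<bar>"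
          using x e nonneg[of x] by (intro mult_right_mono power_mono) auto
        moreover have "- (\<phi> x ^ n * \<bar>G x\<bar>) \<le> \<phi> x ^ n * G x"
          using mult_left_mono[of "- \<bar>G x\<bar>" "G x" "\<phi> x ^ n"] x e nonneg[of x] by simp
        ultimately show "- (\<phi> e ^ n * \<bar>G x\<bar>) \<le> \<phi> x ^ n * G x" by linarith
      qed (use e int[of e b n] intG(2)[of e b] in
          \<open>auto intro!: integrable_neg integrable_on_mult_right\<close>)
      finally show ?thesis .
    qed
    show ?thesis using 1 2 3 split by linarith
  qed
  have pc: "\<phi> e < \<phi> c" "0 \<le> \<phi> e" using anti[of c e] nonneg[of e] c e by auto
  then have "(\<lambda>n. K * (\<phi> e / \<phi> c) ^ n) \<longlonglongrightarrow> K * 0"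
    by (intro tendsto_intros LIMSEQ_realpow_zero) auto
  then have "\<forall>\<^sub>F n in sequentially. K * (\<phi> e / \<phi> c) ^ n < I"
    using I by (intro order_tendstoD(2)) auto
  then show ?thesis
  proof eventually_elim
    case (elim n)
    then have "K * \<phi> e ^ n < I * \<phi> c ^ n" using pc by (simp add: power_divide field_simps)
    then show ?case using main[of n] by (simp add: mult.commute)
  qed
qed

section \<open>Sign of a sine sum to the right of 0\<close>

lemma deriv_pos_right_imp_pos_right:
  fixes f f' :: "real \<Rightarrow> real"
  assumes der: "\<And>x. (f has_real_derivative f' x) (at x)" and "f 0 = 0"
    and "\<exists>e>0. \<forall>x. 0 < x \<longrightarrow> x < e \<longrightarrow> 0 < f' x"
  shows "\<exists>e>0. \<forall>x. 0 < x \<longrightarrow> x < e \<longrightarrow> 0 < f x"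
proof -
  obtain e where e: "e > 0" "\<And>x. 0 < x \<Longrightarrow> x < e \<Longrightarrow> 0 < f' x" using assms(3) by blast
  have "0 < f x" if x: "0 < x" "x < e" for x
  proof -
    have "f 0 < f x"
    proof (rule DERIV_pos_imp_increasing_open[OF x(1)])
      show "continuous_on {0..x} f"
        using der by (intro DERIV_continuous_on) (auto intro: has_field_derivative_at_within)
      show "\<exists>y. (f has_real_derivative y) (at u) \<and> 0 < y" if "0 < u" "u < x" for u
        using der e that x by (meson order_less_trans)
    qed
    then show ?thesis using \<open>f 0 = 0\<close> by simp
  qed
  with e show ?thesis by blast
qed

text \<open>The expansion at 0 is odd, with linear coefficient the sum of \<open>w i * x i\<close>
  and cubic coefficient minus one sixth of the sum of \<open>w i * x i ^ 3\<close>; the first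
  nonzero one decides.\<close>

lemma sum_sin_pos_right:
  fixes w x :: "'b \<Rightarrow> real"
  assumes "0 < (\<Sum>i\<in>A. w i * x i) \<or>
    (\<Sum>i\<in>A. w i * x i) = 0 \<and> (\<Sum>i\<in>A. w i * x i ^ 3) < 0"
  shows "\<exists>e>0. \<forall>t. 0 < t \<longrightarrow> t < e \<longrightarrow> 0 < (\<Sum>i\<in>A. w i * sin (x i * t))"
proof -
  define g0 where "g0 t = (\<Sum>i\<in>A. w i * sin (x i * t))" for t
  define g1 where "g1 t = (\<Sum>i\<in>A. w i * (x i * cos (x i * t)))" for t
  define g2 where "g2 t = (\<Sum>i\<in>A. - (w i * (x i * x i * sin (x i * t))))" for t
  define g3 where "g3 t = (\<Sum>i\<in>A. - (w i * (x i ^ 3 * cos (x i * t))))" for t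
  have d: "(g0 has_real_derivative g1 t) (at t)" "(g1 has_real_derivative g2 t) (at t)"
      "(g2 has_real_derivative g3 t) (at t)" for t
    unfolding g0_def g1_def g2_def g3_def
    by (auto intro!: derivative_eq_intros sum.cong simp: power3_eq_cube)
  have z: "g0 0 = 0" "g2 0 = 0" by (simp_all add: g0_def g2_def)
  have "\<exists>e>0. \<forall>t. 0 < t \<longrightarrow> t < e \<longrightarrow> 0 < g0 t"
  proof (cases "0 < g1 0")
    case True
    from DERIV_pos_inc_right[OF d(1) this] z show ?thesis by simp
  next
    case False
    with assms have g1: "g1 0 = 0" and g3: "0 < g3 0" by (auto simp: g1_def g3_def sum_negf)
    from DERIV_pos_inc_right[OF d(3) g3] z have "\<exists>e>0. \<forall>t. 0 < t \<longrightarrow> t < e \<longrightarrow> 0 < g2 t" by simp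
    \<comment> \<open>Positivity passes from \<open>g2\<close> to \<open>g1\<close> and on to
      \<open>g0\<close>, both of which vanish at 0.\<close>
    then show ?thesis
      using deriv_pos_right_imp_pos_right[OF d(1) z(1) deriv_pos_right_imp_pos_right[OF d(2) g1]] by simp
  qed
  then show ?thesis by (simp add: g0_def)
qed

text \<open>Here \<open>x i\<close> is the frequency in the Fourier integral. Arbitrary real weights
  admit the binomial weights as well as their negatives.\<close>

lemma eventually_sum_lazy_diff_pos:
  fixes w :: "'b \<Rightarrow> real" and k :: "'b \<Rightarrow> int"
  assumes s: "0 < s" "s \<le> 1 / 4" and "finite A"
    and x: "\<And>i. i \<in> A \<Longrightarrow> real_of_int (k i) + 1 / 2 = x i"
    and w: "0 < (\<Sum>i\<in>A. w i * x i) \<or>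
      (\<Sum>i\<in>A. w i * x i) = 0 \<and> (\<Sum>i\<in>A. w i * x i ^ 3) < 0"
  shows "\<forall>\<^sub>F n in sequentially. 0 < (\<Sum>i\<in>A. w i * lazy_diff s n (k i))"
proof -
  define \<phi> where "\<phi> t = 1 - 2 * s + 2 * s * cos t" for t
  define G where "G t = (\<Sum>i\<in>A. w i * sin (x i * t)) * sin (t / 2)" for t
  obtain e where e: "e > 0" "\<And>t. 0 < t \<Longrightarrow> t < e \<Longrightarrow> 0 < (\<Sum>i\<in>A. w i * sin (x i * t))"
    using sum_sin_pos_right[OF w] by blast
  have "\<forall>\<^sub>F n in sequentially. 0 < integral {0..pi} (\<lambda>t. \<phi> t ^ n * G t)"
  proof (rule eventually_integral_power_pos[where ?e0.0 = "min e pi"])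
    show "\<phi> v < \<phi> u" if "0 \<le> u" "u < v" "v \<le> pi" for u v
      using cos_monotone_0_pi[of u v] that s by (simp add: \<phi>_def)
    \<comment> \<open>The least value is \<open>1 - 4 * s\<close>, attained at
      \<open>pi\<close>.\<close>
    show "0 \<le> \<phi> u" for u
    proof -
      have "s * (1 - cos u) \<le> s * 2" using s cos_ge_minus_one[of u] by (intro mult_left_mono) linarith+
      then show ?thesis using s by (simp add: \<phi>_def algebra_simps)
    qed
    show "0 < G t" if "0 < t" "t < min e pi" for t
      using e that by (auto simp: G_def intro!: mult_pos_pos sin_gt_zero)
  qed (use e in \<open>auto simp: \<phi>_def G_def intro!: continuous_intros\<close>)
  moreover have "integral {0..pi} (\<lambda>t. \<phi> t ^ n * G t) = pi / 2 * (\<Sum>i\<in>A. w i * lazy_diff s n (k i))" for n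
  proof (rule integral_unique)
    have "((\<lambda>t. \<Sum>i\<in>A. w i * ((1 - 2 * s + 2 * s * cos t) ^ n *
              (sin ((2 * of_int (k i) + 1) / 2 * t) * sin (t / 2)))) has_integral
          (\<Sum>i\<in>A. w i * (pi / 2 * lazy_diff s n (k i)))) {0..pi}"
      using \<open>finite A\<close> by (intro has_integral_sum has_integral_mult_right lazy_diff_has_integral) auto
    also have "(\<lambda>t. \<Sum>i\<in>A. w i * ((1 - 2 * s + 2 * s * cos t) ^ n *
              (sin ((2 * of_int (k i) + 1) / 2 * t) * sin (t / 2)))) = (\<lambda>t. \<phi> t ^ n * G t)"
      unfolding G_def \<phi>_def sum_distrib_left sum_distrib_right
      using x by (intro ext sum.cong refl) (simp add: add_divide_distrib mult.left_commute flip: x)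
    finally show "((\<lambda>t. \<phi> t ^ n * G t) has_integral
        pi / 2 * (\<Sum>i\<in>A. w i * lazy_diff s n (k i))) {0..pi}"
      by (simp add: sum_distrib_left mult.left_commute)
  qed
  ultimately show ?thesis by (simp add: zero_less_mult_iff)
qed

text \<open>The deciding moments are those of \<open>d - 1/2\<close> minus a binomial variable. The
  first is \<open>d - 1/2 - r * a\<close>; if it is 0, the third is minus the third central moment,
  of sign opposite to \<open>1 - 2 * a\<close>.\<close>

lemma eventually_binomial_mean_lazy_diff:
  fixes a s :: real and r d :: nat and U :: "nat \<Rightarrow> real"
  assumes a: "0 < a" "a < 1" and s: "0 < s" "s \<le> 1 / 4" and "1 \<le> r"
  defines "U \<equiv> \<lambda>n. binomial_mean r a (\<lambda>i. lazy_diff s n (int d - 1 - int i))"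
  shows "2 * a * real r < 2 * real d - 1 \<or> 2 * a * real r = 2 * real d - 1 \<and> a < 1 / 2
      \<Longrightarrow> \<forall>\<^sub>F n in sequentially. 0 < U n"
    and "2 * real d - 1 < 2 * a * real r \<or> 2 * a * real r = 2 * real d - 1 \<and> 1 / 2 < a
      \<Longrightarrow> \<forall>\<^sub>F n in sequentially. U n < 0"
proof -
  define x where "x i = real d - 1 / 2 - real i" for i
  define m where "m = real d - 1 / 2 - real r * a"
  let ?B = "\<lambda>i. Bernstein r i a"
  have x: "real_of_int (int d - 1 - int i) + 1 / 2 = x i" for i by (simp add: x_def)
  have m1: "(\<Sum>i\<le>r. ?B i * x i) = m"
  proof -
    have "(\<Sum>i\<le>r. ?B i * x i) = binomial_mean r a (\<lambda>i. m + (-1) * (real i - real r * a))"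
      by (simp add: binomial_mean_def x_def m_def algebra_simps)
    then show ?thesis unfolding binomial_mean_add binomial_mean_cmult binomial_mean_central by simp
  qed
  have m3: "(\<Sum>i\<le>r. ?B i * x i ^ 3) = - (real r * a * (1 - a) * (1 - 2 * a))" if "m = 0"
  proof -
    have "x i ^ 3 = - ((real i - real r * a) ^ 3)" for i
    proof -
      have "x i = - (real i - real r * a)" using that by (simp add: x_def m_def)
      then show ?thesis using power_minus_odd[of 3 "real i - real r * a"] by simp
    qed
    then have "(\<Sum>i\<le>r. ?B i * x i ^ 3) = - binomial_mean r a (\<lambda>i. (real i - real r * a) ^ 3)"
      by (simp only: binomial_mean_def mult_minus_right sum_negf)
    then show ?thesis by (simp only: binomial_third_central_moment)
  qed
  have c: "0 < real r * a * (1 - a)" using a \<open>1 \<le> r\<close> by simp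
  have sgn: "0 < real r * a * (1 - a) * (1 - 2 * a)" if "a < 1 / 2"
    using that by (intro mult_pos_pos[OF c]) simp
  have sgn': "real r * a * (1 - a) * (1 - 2 * a) < 0" if "1 / 2 < a"
    using that by (intro mult_pos_neg[OF c]) simp
  show "\<forall>\<^sub>F n in sequentially. 0 < U n"
    if "2 * a * real r < 2 * real d - 1 \<or> 2 * a * real r = 2 * real d - 1 \<and> a < 1 / 2"
    unfolding U_def binomial_mean_def
  proof (rule eventually_sum_lazy_diff_pos[OF s finite_atMost x])
    show "0 < (\<Sum>i\<le>r. ?B i * x i) \<or> (\<Sum>i\<le>r. ?B i * x i) = 0 \<and> (\<Sum>i\<le>r. ?B i * x i ^ 3) < 0"
    proof -
      have "0 < m \<or> m = 0 \<and> a < 1 / 2" using that by (auto simp: m_def algebra_simps)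
      then show ?thesis unfolding m1 using m3 sgn by auto
    qed
  qed
  show "\<forall>\<^sub>F n in sequentially. U n < 0"
    if "2 * real d - 1 < 2 * a * real r \<or> 2 * a * real r = 2 * real d - 1 \<and> 1 / 2 < a"
  proof -
    have "\<forall>\<^sub>F n in sequentially. 0 < (\<Sum>i\<le>r. - ?B i * lazy_diff s n (int d - 1 - int i))"
    proof (rule eventually_sum_lazy_diff_pos[OF s finite_atMost x])
      show "0 < (\<Sum>i\<le>r. - ?B i * x i) \<or> (\<Sum>i\<le>r. - ?B i * x i) = 0 \<and> (\<Sum>i\<le>r. - ?B i * x i ^ 3) < 0"
      proof -
        have "m < 0 \<or> m = 0 \<and> 1 / 2 < a" using that by (auto simp: m_def algebra_simps)
        then show ?thesis unfolding mult_minus_left sum_negf m1 using m3 sgn' by auto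
      qed
    qed
    then show ?thesis by (simp add: U_def binomial_mean_def sum_negf)
  qed
qed

subsection \<open>Tails of the difference of two binomials\<close>

text \<open>Conditioning on \<open>A\<close>. The values 1, 0 and -1, 0 will describe one more trial
  in the first and in the second sum.\<close>

lemma (in prob_space) prob_add_two_valued:
  fixes A B :: "'a \<Rightarrow> real"
  assumes indep: "indep_var borel A borel B" and xy: "x \<noteq> y"
    and A: "prob {\<omega> \<in> space M. A \<omega> = x} = a" "prob {\<omega> \<in> space M. A \<omega> = y} = 1 - a"
  shows "prob {\<omega> \<in> space M. k \<le> A \<omega> + B \<omega>} =
    a * prob {\<omega> \<in> space M. k - x \<le> B \<omega>} + (1 - a) * prob {\<omega> \<in> space M. k - y \<le> B \<omega>}"
proof -
  have [measurable]: "random_variable borel A" "random_variable borel B"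
    using indep_var_rv1[OF indep] indep_var_rv2[OF indep] by auto
  have prod: "prob {\<omega> \<in> space M. A \<omega> = z \<and> k - z \<le> B \<omega>}
      = prob {\<omega> \<in> space M. A \<omega> = z} * prob {\<omega> \<in> space M. k - z \<le> B \<omega>}" for z
  proof -
    have "prob ((\<lambda>\<omega>. (A \<omega>, B \<omega>)) -` ({z} \<times> {k - z..}) \<inter> space M)
        = prob (A -` {z} \<inter> space M) * prob (B -` {k - z..} \<inter> space M)"
      by (rule indep_varD[OF indep]) auto
    moreover have "(\<lambda>\<omega>. (A \<omega>, B \<omega>)) -` ({z} \<times> {k - z..}) \<inter> space M = {\<omega> \<in> space M. A \<omega> = z \<and> k - z \<le> B \<omega>}"
      "A -` {z} \<inter> space M = {\<omega> \<in> space M. A \<omega> = z}"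
      "B -` {k - z..} \<inter> space M = {\<omega> \<in> space M. k - z \<le> B \<omega>}"
      by auto
    ultimately show ?thesis by simp
  qed
  \<comment> \<open>The two probabilities add up to 1, so \<open>A\<close> takes no other value
    outside a null set.\<close>
  have "prob ({\<omega> \<in> space M. A \<omega> = x} \<union> {\<omega> \<in> space M. A \<omega> = y}) = 1"
    using xy A by (subst finite_measure_Union) auto
  then have "AE \<omega> in M. \<omega> \<in> {\<omega> \<in> space M. A \<omega> = x} \<union> {\<omega> \<in> space M. A \<omega> = y}"
    by (subst (asm) prob_eq_1) auto
  then have "prob {\<omega> \<in> space M. k \<le> A \<omega> + B \<omega>}
      = prob ({\<omega> \<in> space M. A \<omega> = x \<and> k - x \<le> B \<omega>} \<union> {\<omega> \<in> space M. A \<omega> = y \<and> k - y \<le> B \<omega>})"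
    by (intro finite_measure_eq_AE) (auto simp: algebra_simps)
  also have "\<dots> = prob {\<omega> \<in> space M. A \<omega> = x \<and> k - x \<le> B \<omega>} + prob {\<omega> \<in> space M. A \<omega> = y \<and> k - y \<le> B \<omega>}"
    using xy by (intro finite_measure_Union) auto
  finally show ?thesis unfolding prod A .
qed

text \<open>\<open>T m n k\<close> stands for the probability that the sum of \<open>m\<close>
  trials exceeds that of \<open>n\<close> others by at least \<open>k\<close>. Inside the locale
  only algebra with these recursions remains.\<close>

locale binomial_tails =
  fixes a :: real and T :: "nat \<Rightarrow> nat \<Rightarrow> int \<Rightarrow> real"
  assumes T_0: "T 0 0 k = of_bool (k \<le> 0)"
    and T_left: "T (Suc m) n k = a * T m n (k - 1) + (1 - a) * T m n k"
    and T_right: "T m (Suc n) k = a * T m n (k + 1) + (1 - a) * T m n k"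
begin

text \<open>One trial on each side moves the difference by 1 or -1 with probability
  \<open>a * (1 - a)\<close> each.\<close>

lemma T_diagonal:
  "T (Suc m) (Suc n) k = (1 - 2 * (a * (1 - a))) * T m n k
     + a * (1 - a) * (T m n (k - 1) + T m n (k + 1))"
  unfolding T_left T_right by (simp add: algebra_simps)

text \<open>A second difference of tails is a difference of neighbouring point probabilities; both
  sides have the same recursion and initial values.\<close>

lemma second_difference_diagonal:
  "T n n k - 2 * T n n (k + 1) + T n n (k + 2) = lazy_diff (a * (1 - a)) n k"
proof (induction n arbitrary: k)
  case (Suc n)
  have k: "k - 1 + 1 = k" "k - 1 + 2 = k + 1" "k + 1 + 1 = k + 2" "k + 1 + 2 = k + 3" "k + 1 - 1 = k"
    "k + 2 - 1 = k + 1" "k + 2 + 1 = k + 3" by auto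
  show ?case
    unfolding lazy_diff.simps Suc[symmetric] T_diagonal k by algebra
qed (auto simp: T_0)

text \<open>The \<open>r\<close> surplus trials shift the threshold by their sum, so the diagonal
  identity is averaged over it.\<close>

lemma second_difference:
  "T (n + r) n k - 2 * T (n + r) n (k + 1) + T (n + r) n (k + 2)
     = binomial_mean r a (\<lambda>i. lazy_diff (a * (1 - a)) n (k - int i))"
proof (induction r arbitrary: k)
  case (Suc r)
  have k: "k - 1 + 1 = k" "k - 1 + 2 = k + 1" "k + 1 - 1 = k" "k + 2 - 1 = k + 1" by auto
  have i: "k - int (Suc i) = k - 1 - int i" for i by simp
  show ?case
    unfolding binomial_mean_Suc add_Suc_right T_left k i
      Suc[of k, symmetric] Suc[of "k - 1", unfolded k, symmetric] by algebra
qed (simp add: second_difference_diagonal)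

text \<open>A lazy step adds a multiple of the discrete Laplacian at \<open>k\<close>, that is, of
  the second difference starting at \<open>k - 1\<close>.\<close>

lemma T_increment:
  "T (Suc n + r) (Suc n) k - T (n + r) n k =
     a * (1 - a) * binomial_mean r a (\<lambda>i. lazy_diff (a * (1 - a)) n (k - 1 - int i))"
  unfolding second_difference[symmetric] add_Suc T_diagonal by (simp add: algebra_simps)

text \<open>Exchanging successes and failures of a fair coin sends the difference \<open>D\<close>
  to \<open>m - n - D\<close>, so the two terms are probabilities of complementary events.\<close>

lemma T_symmetric:
  assumes "a = 1 / 2"
  shows "T m n k + T m n (int m - int n + 1 - k) = 1"
proof (induction m arbitrary: n k)
  case 0
  show ?case
  proof (induction n arbitrary: k)
    case (Suc n)
    have k: "int 0 - int n + 1 - (k + 1) + 1 = int 0 - int n + 1 - k"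
            "int 0 - int (Suc n) + 1 - k = int 0 - int n + 1 - (k + 1)" by simp_all
    show ?case
      using Suc[of k] Suc[of "k + 1"] unfolding T_right k assms by simp
  qed (auto simp: T_0)
next
  case (Suc m)
  have k: "int m - int n + 1 - (k - 1) - 1 = int m - int n + 1 - k"
          "int (Suc m) - int n + 1 - k = int m - int n + 1 - (k - 1)" by simp_all
  show ?case
    using Suc[of n k] Suc[of n "k - 1"] unfolding T_left k assms by simp
qed

end

section \<open>From the random variables to the recursions\<close>

lemma binomial_tails_iid_bernoulli_pair:
  assumes "prob_space M" and iid: "iid_bernoulli_pair M a X X'"
  shows "binomial_tails a
    (\<lambda>m n k. measure M {\<omega> \<in> space M. partial_sum X m \<omega> \<ge> partial_sum X' n \<omega> + real_of_int k})"
proof -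
  interpret prob_space M by fact
  \<comment> \<open>With the second sequence negated, the difference is one sum over a disjoint
    union, and a new trial is one more index, independent of the sum so far.\<close>
  define Y where "Y = case_sum X (\<lambda>i \<omega>. - X' i \<omega>)"
  define D where "D m n \<omega> = (\<Sum>z\<in>{1..m} <+> {1..n}. Y z \<omega>)" for m n \<omega>
  have D: "D m n \<omega> = partial_sum X m \<omega> - partial_sum X' n \<omega>" for m n \<omega>
    by (simp add: D_def Y_def partial_sum_def sum.Plus sum_negf)
  define f :: "nat + nat \<Rightarrow> real \<Rightarrow> real"
    where "f = case_sum (\<lambda>_ x. x) (\<lambda>_ x. - x)"
  have "indep_vars (\<lambda>_. borel) (case_sum X X') ({1..} <+> {1..})"
    using iid by (simp add: iid_bernoulli_pair_def)
  then have "indep_vars (\<lambda>_. borel) (\<lambda>z \<omega>. f z (case_sum X X' z \<omega>)) ({1..} <+> {1..})"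
    by (rule indep_vars_compose2) (auto simp: f_def)
  also have "(\<lambda>z \<omega>. f z (case_sum X X' z \<omega>)) = Y"
    by (auto simp: Y_def f_def fun_eq_iff split: sum.split)
  finally have indep: "indep_vars (\<lambda>_. borel) Y ({1..} <+> {1..})" .
  have indep_D: "indep_var borel (Y z) borel (D m n)"
    if "z \<in> {1..} <+> {1..}" "z \<notin> {1..m} <+> {1..n}" for z m n
    unfolding D_def using that
    by (intro indep_vars_sum indep_vars_subset[OF indep]) auto
  have ins: "{1..Suc m} <+> {1..n} = insert (Inl (Suc m)) ({1..m} <+> {1..n})"
            "{1..m} <+> {1..Suc n} = insert (Inr (Suc n)) ({1..m} <+> {1..n})" for m n :: nat
    by (auto simp: le_Suc_eq)
  have D_Suc: "D (Suc m) n \<omega> = Y (Inl (Suc m)) \<omega> + D m n \<omega>"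
              "D m (Suc n) \<omega> = Y (Inr (Suc n)) \<omega> + D m n \<omega>" for m n \<omega>
    unfolding D_def ins by (subst sum.insert; auto)+
  have Y: "prob {\<omega> \<in> space M. Y (Inl (Suc m)) \<omega> = 1} = a"
          "prob {\<omega> \<in> space M. Y (Inl (Suc m)) \<omega> = 0} = 1 - a"
          "prob {\<omega> \<in> space M. Y (Inr (Suc m)) \<omega> = - 1} = a"
          "prob {\<omega> \<in> space M. Y (Inr (Suc m)) \<omega> = 0} = 1 - a" for m
    using iid by (auto simp: Y_def iid_bernoulli_pair_def)
  have "binomial_tails a (\<lambda>m n k. prob {\<omega> \<in> space M. real_of_int k \<le> D m n \<omega>})"
  proof
    show "prob {\<omega> \<in> space M. real_of_int k \<le> D 0 0 \<omega>} = of_bool (k \<le> 0)" for k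
      by (simp add: D partial_sum_def prob_space)
    show "prob {\<omega> \<in> space M. real_of_int k \<le> D (Suc m) n \<omega>}
        = a * prob {\<omega> \<in> space M. real_of_int (k - 1) \<le> D m n \<omega>}
          + (1 - a) * prob {\<omega> \<in> space M. real_of_int k \<le> D m n \<omega>}" for m n k
      unfolding D_Suc
      by (subst prob_add_two_valued[OF indep_D _ Y(1,2)]) auto
    show "prob {\<omega> \<in> space M. real_of_int k \<le> D m (Suc n) \<omega>}
        = a * prob {\<omega> \<in> space M. real_of_int (k + 1) \<le> D m n \<omega>}
          + (1 - a) * prob {\<omega> \<in> space M. real_of_int k \<le> D m n \<omega>}" for m n k
      unfolding D_Suc
      by (subst prob_add_two_valued[OF indep_D _ Y(3,4)]) auto
  qed
  then show ?thesis by (simp add: D algebra_simps)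
qed

section \<open>From consecutive terms to monotonicity\<close>

lemma strict_mono_on_atLeast_SucI:
  fixes f :: "nat \<Rightarrow> 'b::order"
  assumes "\<And>n. m \<le> n \<Longrightarrow> f n < f (Suc n)"
  shows "strict_mono_on {m..} f"
proof (rule strict_mono_onI)
  fix x y assume xy: "x \<in> {m..}" "y \<in> {m..}" "x < y"
  have "strict_mono (\<lambda>k. f (m + k))"
    using assms by (simp add: strict_mono_Suc_iff)
  from strict_monoD[OF this, of "x - m" "y - m"] xy show "f x < f y" by simp
qed

lemma monotone_on_greater_atLeast_SucI:
  fixes f :: "nat \<Rightarrow> real"
  assumes "\<And>n. m \<le> n \<Longrightarrow> f (Suc n) < f n"
  shows "monotone_on {m..} (<) (>) f"
proof (rule monotone_onI)
  fix x y assume xy: "x \<in> {m..}" "y \<in> {m..}" "x < y"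
  have "strict_mono_on {m..} (\<lambda>n. - f n)"
    using assms by (intro strict_mono_on_atLeast_SucI) simp
  from strict_mono_onD[OF this xy] show "f y < f x" by simp
qed

theorem theorem4:
  fixes M :: "'a measure"
    and X X' :: "nat \<Rightarrow> 'a \<Rightarrow> real"
    and \<alpha> :: real
    and r d :: nat
    and p :: "nat \<Rightarrow> real"
  assumes "prob_space M"
    and "0 < \<alpha>" and "\<alpha> < 1"
    and "r \<ge> 1" and "d \<ge> 1"
    and "iid_bernoulli_pair M \<alpha> X X'"
  defines "p \<equiv> exceed_prob M X X' r d"
  shows
    "(r \<le> d - 1 \<longrightarrow> mono p \<and> strict_mono_on {d - 1 - r..} p) \<and>
     (d \<le> r \<and> r \<le> 2 * d - 2 \<longrightarrow>
        (\<alpha> < real d / (real r + 1) \<longrightarrow> increasing_seq p) \<and>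
        (real d / (real r + 1) \<le> \<alpha> \<and> \<alpha> < (2 * real d - 1) / (2 * real r) \<longrightarrow> increasing_for_large p) \<and>
        ((2 * real d - 1) / (2 * real r) \<le> \<alpha> \<longrightarrow> decreasing_for_large p)) \<and>
     (r = 2 * d - 1 \<longrightarrow>
        (\<alpha> < 1 / 2 \<longrightarrow> increasing_seq p) \<and>
        (\<alpha> = 1 / 2 \<longrightarrow> (\<forall>n. p n = 1 / 2)) \<and>
        (\<alpha> > 1 / 2 \<longrightarrow> decreasing_seq p)) \<and>
     (r \<ge> 2 * d \<longrightarrow>
        (\<alpha> \<le> (2 * real d - 1) / (2 * real r) \<longrightarrow> increasing_for_large p) \<and>
        ((2 * real d - 1) / (2 * real r) < \<alpha> \<and> \<alpha> \<le> real d / (real r + 1) \<longrightarrow> decreasing_for_large p) \<and>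
        (real d / (real r + 1) < \<alpha> \<longrightarrow> decreasing_seq p))"
proof -
  let ?T = "\<lambda>m n k. measure M {\<omega> \<in> space M. partial_sum X m \<omega> \<ge> partial_sum X' n \<omega> + real_of_int k}"
  interpret binomial_tails \<alpha> ?T
    by (rule binomial_tails_iid_bernoulli_pair[OF \<open>prob_space M\<close> \<open>iid_bernoulli_pair M \<alpha> X X'\<close>])
  define s where "s = \<alpha> * (1 - \<alpha>)"
  define U where "U n = binomial_mean r \<alpha> (\<lambda>i. lazy_diff s n (int d - 1 - int i))" for n
  have a: "0 < \<alpha>" "\<alpha> < 1" by fact+
  have s: "0 < s" using a by (simp add: s_def)
  have s4: "s \<le> 1 / 4"
    using zero_le_power2[of "1 - 2 * \<alpha>"] by (simp add: s_def power2_eq_square algebra_simps)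
  have p: "p n = ?T (n + r) n (int d)" for n
    by (simp add: p_def exceed_prob_def)
  \<comment> \<open>As \<open>s\<close> is positive, the sign of \<open>U n\<close> decides between
    increase and decrease.\<close>
  have inc: "p (Suc n) - p n = s * U n" for n
    unfolding p U_def s_def by (rule T_increment)
  have up: "p n < p (Suc n)" if "0 < U n" for n
    using inc[of n] mult_pos_pos[OF s that] by linarith
  have down: "p (Suc n) < p n" if "U n < 0" for n
    using inc[of n] mult_pos_neg[OF s that] by linarith
  have inc_large: "increasing_for_large p" if ev: "\<forall>\<^sub>F n in sequentially. 0 < U n"
  proof -
    obtain N where "\<And>n. N \<le> n \<Longrightarrow> 0 < U n" using ev unfolding eventually_sequentially by blast
    then have "strict_mono_on {N..} p" by (intro strict_mono_on_atLeast_SucI up)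
    then show ?thesis unfolding increasing_for_large_def by blast
  qed
  have dec_large: "decreasing_for_large p" if ev: "\<forall>\<^sub>F n in sequentially. U n < 0"
  proof -
    obtain N where "\<And>n. N \<le> n \<Longrightarrow> U n < 0" using ev unfolding eventually_sequentially by blast
    then have "monotone_on {N..} (<) (>) p" by (intro monotone_on_greater_atLeast_SucI down)
    then show ?thesis unfolding decreasing_for_large_def by blast
  qed
  have U_nonneg: "0 \<le> U n" if "r \<le> 2 * d - 1" "\<alpha> * (real r + 1) < real d" for n
    unfolding U_def by (rule binomial_mean_lazy_diff_pos(1)[OF a \<open>1 \<le> d\<close> s s4 that])
  have U_pos: "0 < U n" if "r \<le> 2 * d - 1" "\<alpha> * (real r + 1) < real d" "d - 1 \<le> n + r" for n
    unfolding U_def by (rule binomial_mean_lazy_diff_pos(2)[OF a \<open>1 \<le> d\<close> s s4 that])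
  have U_neg: "U n < 0" if "2 * d - 1 \<le> r" "real d < \<alpha> * (real r + 1)" for n
    unfolding U_def by (rule binomial_mean_lazy_diff_neg[OF a \<open>1 \<le> d\<close> s s4 that])
  have U_large_pos: "\<forall>\<^sub>F n in sequentially. 0 < U n"
    if "2 * \<alpha> * real r < 2 * real d - 1 \<or> 2 * \<alpha> * real r = 2 * real d - 1 \<and> \<alpha> < 1 / 2"
    unfolding U_def by (rule eventually_binomial_mean_lazy_diff(1)[OF a s s4 \<open>1 \<le> r\<close> that])
  have U_large_neg: "\<forall>\<^sub>F n in sequentially. U n < 0"
    if "2 * real d - 1 < 2 * \<alpha> * real r \<or> 2 * \<alpha> * real r = 2 * real d - 1 \<and> 1 / 2 < \<alpha>"
    unfolding U_def by (rule eventually_binomial_mean_lazy_diff(2)[OF a s s4 \<open>1 \<le> r\<close> that])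
  \<comment> \<open>\<open>d \<le> r\<close> gives \<open>d - 1 \<le> n + r\<close> already at
    \<open>n = 0\<close>, so the increase is strict from the start.\<close>
  have inc_all: "increasing_seq p" if "r \<le> 2 * d - 1" "d \<le> r" "\<alpha> * (real r + 1) < real d"
    unfolding increasing_seq_def strict_mono_Suc_iff
  proof
    show "p n < p (Suc n)" for n using that(2) by (intro up U_pos that) linarith
  qed
  have dec_all: "decreasing_seq p" if "2 * d - 1 \<le> r" "real d < \<alpha> * (real r + 1)"
  proof -
    have "monotone_on {0..} (<) (>) p"
      by (intro monotone_on_greater_atLeast_SucI down U_neg that)
    then show ?thesis by (simp only: decreasing_seq_def atLeast_0)
  qed
  have c1: "mono p \<and> strict_mono_on {d - 1 - r..} p" if r: "r \<le> d - 1"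
  proof
    \<comment> \<open>Here \<open>r + 1 \<le> d\<close>, so the threshold \<open>d / (r + 1)\<close>
      is at least 1 and \<open>\<alpha>\<close> lies below it.\<close>
    have "\<alpha> * (real r + 1) < 1 * (real r + 1)" using a by (intro mult_strict_right_mono) auto
    also have "\<dots> = real (r + 1)" by simp
    also have "\<dots> \<le> real d" using r \<open>1 \<le> d\<close> by (subst of_nat_le_iff) linarith
    finally have ad: "\<alpha> * (real r + 1) < real d" .
    have r2: "r \<le> 2 * d - 1" using r by linarith
    show "mono p"
    proof (rule incseq_SucI)
      show "p n \<le> p (Suc n)" for n
        using inc[of n] mult_nonneg_nonneg[OF less_imp_le[OF s] U_nonneg[OF r2 ad, of n]] by linarith
    qed
    \<comment> \<open>\<open>d - 1 - r\<close> is the first \<open>n\<close> with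
      \<open>d - 1 \<le> n + r\<close>.\<close>
    show "strict_mono_on {d - 1 - r..} p"
      using U_pos[OF r2 ad] by (intro strict_mono_on_atLeast_SucI up) simp
  qed
  have r0: "0 < real r" using \<open>1 \<le> r\<close> by simp
  have conv: "\<alpha> < real d / (real r + 1) \<longleftrightarrow> \<alpha> * (real r + 1) < real d"
    "real d / (real r + 1) < \<alpha> \<longleftrightarrow> real d < \<alpha> * (real r + 1)"
    "\<alpha> < (2 * real d - 1) / (2 * real r) \<longleftrightarrow> 2 * \<alpha> * real r < 2 * real d - 1"
    "(2 * real d - 1) / (2 * real r) < \<alpha> \<longleftrightarrow> 2 * real d - 1 < 2 * \<alpha> * real r"
    "\<alpha> \<le> (2 * real d - 1) / (2 * real r) \<longleftrightarrow> 2 * \<alpha> * real r \<le> 2 * real d - 1"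
    "(2 * real d - 1) / (2 * real r) \<le> \<alpha> \<longleftrightarrow> 2 * real d - 1 \<le> 2 * \<alpha> * real r"
    using r0 by (simp_all add: field_simps)
  have c2: "decreasing_for_large p"
    if r: "r \<le> 2 * d - 2" and ad: "2 * real d - 1 \<le> 2 * \<alpha> * real r"
  proof (rule dec_large, rule U_large_neg)
    \<comment> \<open>Since \<open>r < 2 * d - 1\<close>, the assumption forces
      \<open>\<alpha> > 1/2\<close>, so at equality the third moment yields decrease.\<close>
    have "1 * real r < 2 * \<alpha> * real r" using r ad \<open>1 \<le> d\<close> by linarith
    then have "1 / 2 < \<alpha>" using r0 by (simp only: mult_less_cancel_right) linarith
    then show "2 * real d - 1 < 2 * \<alpha> * real r \<or> 2 * \<alpha> * real r = 2 * real d - 1 \<and> 1 / 2 < \<alpha>"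
      using ad by auto
  qed
  have c4: "increasing_for_large p"
    if r: "2 * d \<le> r" and ad: "2 * \<alpha> * real r \<le> 2 * real d - 1"
  proof (rule inc_large, rule U_large_pos)
    \<comment> \<open>Since \<open>2 * d - 1 < r\<close>, the assumption forces
      \<open>\<alpha> < 1/2\<close>, so at equality the third moment yields increase.\<close>
    have "2 * \<alpha> * real r < 1 * real r" using r ad by linarith
    then have "\<alpha> < 1 / 2" using r0 by (simp only: mult_less_cancel_right) linarith
    then show "2 * \<alpha> * real r < 2 * real d - 1 \<or> 2 * \<alpha> * real r = 2 * real d - 1 \<and> \<alpha> < 1 / 2"
      using ad by auto
  qed
  have c3: "(\<alpha> < 1 / 2 \<longrightarrow> increasing_seq p) \<and> (\<alpha> = 1 / 2 \<longrightarrow> (\<forall>n. p n = 1 / 2)) \<and>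
    (\<alpha> > 1 / 2 \<longrightarrow> decreasing_seq p)" if r: "r = 2 * d - 1"
  proof (intro conjI impI allI)
    \<comment> \<open>The threshold \<open>d / (r + 1)\<close> is now \<open>1/2\<close>.\<close>
    have rr: "real r + 1 = 2 * real d" using r \<open>1 \<le> d\<close> by (simp add: of_nat_diff)
    have d0: "0 < real d" using \<open>1 \<le> d\<close> by simp
    show "increasing_seq p" if "\<alpha> < 1 / 2"
      using r \<open>1 \<le> d\<close> that d0 by (intro inc_all) (auto simp: rr)
    show "decreasing_seq p" if "\<alpha> > 1 / 2"
      using r \<open>1 \<le> d\<close> that d0 by (intro dec_all) (auto simp: rr)
    show "p n = 1 / 2" if "\<alpha> = 1 / 2" for n
    proof -
      \<comment> \<open>The reflection in \<open>T_symmetric\<close> fixes \<open>d\<close>, so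
        twice \<open>p n\<close> is 1.\<close>
      have reflect: "int (n + r) - int n + 1 - int d = int d" using r \<open>1 \<le> d\<close> by linarith
      show ?thesis using T_symmetric[OF that, where m = "n + r" and n = n and k = "int d"]
        unfolding p reflect by linarith
    qed
  qed
  show ?thesis
  proof (intro conjI impI allI; (elim conjE)?)
    assume "r \<le> d - 1"
    from c1[OF this] show "mono p" "strict_mono_on {d - 1 - r..} p" by simp_all
  next
    assume r: "d \<le> r" "r \<le> 2 * d - 2"
    show "increasing_seq p" if "\<alpha> < real d / (real r + 1)"
      using r that unfolding conv by (intro inc_all) linarith+
    show "increasing_for_large p" if "\<alpha> < (2 * real d - 1) / (2 * real r)"
      using that unfolding conv by (intro inc_large U_large_pos disjI1)
    show "decreasing_for_large p" if "(2 * real d - 1) / (2 * real r) \<le> \<alpha>"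
      using c2[OF r(2)] that by (simp only: conv)
  next
    assume r: "r = 2 * d - 1"
    show "increasing_seq p" if "\<alpha> < 1 / 2" using c3[OF r] that by blast
    show "p n = 1 / 2" if "\<alpha> = 1 / 2" for n using c3[OF r] that by blast
    show "decreasing_seq p" if "\<alpha> > 1 / 2" using c3[OF r] that by blast
  next
    assume r: "2 * d \<le> r"
    show "increasing_for_large p" if "\<alpha> \<le> (2 * real d - 1) / (2 * real r)"
      using c4[OF r] that by (simp only: conv)
    show "decreasing_for_large p" if "(2 * real d - 1) / (2 * real r) < \<alpha>"
      using that unfolding conv by (intro dec_large U_large_neg disjI1)
    show "decreasing_seq p" if "real d / (real r + 1) < \<alpha>"
      using r that unfolding conv by (intro dec_all) linarith+
  qed
qed

end
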